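(* Let $\mathcal{X},\mathcal{Y},\mathcal{Z}$ be Euclidean spaces, let $\emptyset\neq C\subset\mathcal{X}$ be a connected closed embedded submanifold of $\mathcal{X}$, and let $F:=h+g\circ\mathfrak{S}:\mathcal{X}\to\mathbb{R}$ where: $h:\mathcal{X}\to\mathbb{R}$ is continuously differentiable with $\nabla h$ Lipschitz continuous over $C$ with constant $L_{\nabla h}>0$; $\mathfrak{S}:\mathcal{X}\to\mathcal{Z}$ is continuously differentiable; $g:\mathcal{Z}\to\mathbb{R}$ is Lipschitz continuous with constant $L_g>0$ and $\eta$-weakly convex with $\eta>0$; and $\inf_{\bm{x}\in C}F(\bm{x})>-\infty$. Let $\bm{\varphi}:\mathcal{Y}\to\mathcal{X}$ be continuously differentiable with $\bm{\varphi}(\mathcal{Y})=C$. Let $\bm{x}^\star:=\bm{\varphi}(\bm{y}^\star)\in C$ with some $\bm{y}^\star\in\mathcal{Y}$. Suppose that $\bm{\varphi}$ is submersion at $\bm{y}^\star$, i.e., $\mathrm{Ran}(\mathrm{D}\bm{\varphi}(\bm{y}^\star))=T_C(\bm{x}^\star)$. Then $\bm{0}\in\partial_{\rm L}(F+\iota_C)(\bm{x}^\star)$ if and only if $\bm{0}\in\partial_{\rm L}(F\circ\bm{\varphi})(\bm{y}^\star)$.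
   Context: A Euclidean space is a finite-dimensional real Hilbert space. $g$ is $\eta$-weakly convex if $g+\frac{\eta}{2}\|\cdot\|^2$ is convex. $\iota_C(\bm{x})=0$ if $\bm{x}\in C$ and $+\infty$ otherwise. $\mathrm{D}\bm{\varphi}(\bm{y}):\mathcal{Y}\to\mathcal{X}$ is the derivative; $\mathrm{Ran}$ denotes range. Embedded submanifold: $C\subset\mathcal{X}$ is a $d$-dimensional embedded submanifold if each $\bar{\bm{x}}\in C$ has an open neighborhood $\mathcal{N}_{\bar{\bm{x}}}\subset\mathcal{X}$ and a continuously differentiable $H_{\bar{\bm{x}}}:\mathcal{N}_{\bar{\bm{x}}}\to\mathbb{R}^{\dim(\mathcal{X})-d}$ with $C\cap\mathcal{N}_{\bar{\bm{x}}}=H_{\bar{\bm{x}}}^{-1}(\bm{0})$ and $\mathrm{Rank}(\mathrm{D}H_{\bar{\bm{x}}}(\bar{\bm{x}}))=\dim(\mathcal{X})-d$. Subdifferentials: for $J:\mathcal{X}\to\mathbb{R}\cup\{+\infty\}$ and $\bar{\bm{x}}$ with $J(\bar{\bm{x}})<+\infty$, the Fréchet (regular) subdifferential is $\partial_{\rm F}J(\bar{\bm{x}}):=\{\bm{v}\in\mathcal{X}\mid \liminf_{\bm{x}\to\bar{\bm{x}},\bm{x}\neq\bar{\bm{x}}}\frac{J(\bm{x})-J(\bar{\bm{x}})-\langle\bm{v},\bm{x}-\bar{\bm{x}}\rangle}{\|\bm{x}-\bar{\bm{x}}\|}\ge0\}$, and the limiting subdifferential $\partial_{\rm L}J(\bar{\bm{x}})$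 is the set of all $\bm{v}$ for which there exist $\bm{x}_n\to\bar{\bm{x}}$ with $J(\bm{x}_n)\to J(\bar{\bm{x}})$ and $\bm{v}_n\in\partial_{\rm F}J(\bm{x}_n)$ with $\bm{v}_n\to\bm{v}$. Both are empty where $J=+\infty$. The general normal cone is $N_C(\bar{\bm{x}}):=\partial_{\rm L}\iota_C(\bar{\bm{x}})$; for an embedded submanifold it is the linear subspace $\mathrm{Ran}((\mathrm{D}H_{\bar{\bm{x}}}(\bar{\bm{x}}))^* )$, and the tangent space is $T_C(\bar{\bm{x}}):=(N_C(\bar{\bm{x}}))^\perp$. *)

theory Defs
  imports "HOL-Analysis.Analysis"
begin

definition cont_diff_on ::
  "('a::real_normed_vector \<Rightarrow> 'b::real_normed_vector) \<Rightarrow> 'a set \<Rightarrow> bool" where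
  "cont_diff_on f N \<longleftrightarrow>
     (\<exists>f' :: 'a \<Rightarrow> 'a \<Rightarrow>\<^sub>L 'b.
        (\<forall>x\<in>N. (f has_derivative blinfun_apply (f' x)) (at x)) \<and> continuous_on N f')"

(* The codomain R^(DIM('a) - d) of the local defining map H is represented by a linear
   subspace E of 'a of that dimension, since its dimension cannot be a type here.
   The rank of a linear map is the dimension of its range. *)
definition embedded_submanifold :: "nat \<Rightarrow> 'a::euclidean_space set \<Rightarrow> bool" where
  "embedded_submanifold d C \<longleftrightarrow>
     d \<le> DIM('a) \<and>
     (\<forall>x\<in>C. \<exists>(N :: 'a set) (E :: 'a set) (H :: 'a \<Rightarrow> 'a).
        open N \<and> x \<in> N \<and>
        subspace E \<and> dim E = DIM('a) - d \<and>
        H ` N \<subseteq> E \<and> cont_diff_on H N \<and>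
        C \<inter> N = {z \<in> N. H z = 0} \<and>
        dim (range (frechet_derivative H (at x))) = DIM('a) - d)"

(* Extended-valued functions J are meant to omit the value -\<infinity>, so that J x \<noteq> \<infinity> says
   that J x is finite; all functions below are of this kind. *)
definition frechet_subdiff :: "('a::euclidean_space \<Rightarrow> ereal) \<Rightarrow> 'a \<Rightarrow> 'a set" where
  "frechet_subdiff J x =
     {v. J x \<noteq> \<infinity> \<and>
         Liminf (at x) (\<lambda>z. (J z - J x - ereal (v \<bullet> (z - x))) / ereal (norm (z - x))) \<ge> 0}"

definition limiting_subdiff :: "('a::euclidean_space \<Rightarrow> ereal) \<Rightarrow> 'a \<Rightarrow> 'a set" where
  "limiting_subdiff J x =
     {v. J x \<noteq> \<infinity> \<and>
         (\<exists>(xs :: nat \<Rightarrow> 'a) (vs :: nat \<Rightarrow> 'a).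
            xs \<longlonglongrightarrow> x \<and> (\<lambda>n. J (xs n)) \<longlonglongrightarrow> J x \<and>
            (\<forall>n. vs n \<in> frechet_subdiff J (xs n)) \<and> vs \<longlonglongrightarrow> v)}"

definition indicator_fn :: "'a set \<Rightarrow> 'a \<Rightarrow> ereal" where
  "indicator_fn C x = (if x \<in> C then 0 else \<infinity>)"

definition normal_cone :: "'a::euclidean_space set \<Rightarrow> 'a \<Rightarrow> 'a set" where
  "normal_cone C x = limiting_subdiff (indicator_fn C) x"

definition tangent_space :: "'a::euclidean_space set \<Rightarrow> 'a \<Rightarrow> 'a set" where
  "tangent_space C x = orthogonal_comp (normal_cone C x)"

definition weakly_convex :: "real \<Rightarrow> ('a::real_inner \<Rightarrow> real) \<Rightarrow> bool" where
  "weakly_convex \<eta> g \<longleftrightarrow> convex_on UNIV (\<lambda>z. g z + \<eta> / 2 * (norm z)\<^sup>2)"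

end

(* Put m(u) = <grad h(x), u> + g(S x + DS(x) u) - g(S x) + (\<eta>/2) |DS(x) u|^2 with x = x_star.
   Weak convexity makes m convex with m(0) = 0, so t m(u) dominates m(t u) for t in [0,1]; hence
   a (limiting) subgradient v of F + \<iota>_C at x satisfies v.u <= m(u) for every u that is, in
   the limit, a velocity of curves in C starting at nearby points of C. Conversely m and F have
   the same first-order expansion at x, so m >= 0 on a set approximating C - x up to o(|z - x|)
   already makes 0 a Frechet subgradient. Thus stationarity means m >= 0 on the tangent space.
   The same criterion for F o \<phi> (with C the whole space) reads: m(D\<phi>(y_star) w) >= 0 for all w.
   These agree because the range of D\<phi>(y_star) is the tangent space.

   For the manifold C = {H = 0}, write A = DH(x) and let B be a right inverse of A on its range.
   Then z + B (H z - A z) has derivative id at x and A maps it to H z, so the inverse function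
   theorem straightens C to the kernel of A. Kernel directions are orthogonal to the normal cone, and
   H o \<phi> = 0 puts the range of D\<phi>(y_star) in the kernel, so both equal the tangent space. *)

theory Submission
  imports Defs
begin

section \<open>Weak convexity along segments and Frechet subgradients in \<epsilon> form\<close>

text \<open>Convexity is applied to \<open>g\<close> plus its quadratic term at \<open>p\<close> and
  \<open>p + q\<close>. The squared norm of the convex combination falls short of the combination of
  squared norms by exactly \<open>t * (1 - t)\<close> times the squared norm of \<open>q\<close>,
  which turns the two end-point quadratics into terms in \<open>q\<close> alone.\<close>

lemma weakly_convex_chord:
  assumes "weakly_convex \<eta> g" "0 \<le> t" "t \<le> 1"
  shows "g (p + t *\<^sub>R q) - g p \<le> t * (g (p + q) - g p + \<eta> / 2 * (norm q)\<^sup>2) - \<eta> / 2 * t\<^sup>2 * (norm q)\<^sup>2"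
proof -
  have "(1 - t) *\<^sub>R p + t *\<^sub>R (p + q) = p + t *\<^sub>R q"
    by (simp add: algebra_simps)
  with convex_onD[OF assms(1)[unfolded weakly_convex_def] assms(2,3), of p "p + q"]
  have "g (p + t *\<^sub>R q) + \<eta> / 2 * (norm (p + t *\<^sub>R q))\<^sup>2 \<le>
      (1 - t) * (g p + \<eta> / 2 * (norm p)\<^sup>2) + t * (g (p + q) + \<eta> / 2 * (norm (p + q))\<^sup>2)"
    by simp
  moreover have "(norm (p + t *\<^sub>R q))\<^sup>2 = (1 - t) * (norm p)\<^sup>2 + t * (norm (p + q))\<^sup>2 - t * (1 - t) * (norm q)\<^sup>2"
    unfolding power2_norm_eq_inner
    by (simp add: inner_add_left inner_add_right inner_commute algebra_simps)
  then have "\<eta> / 2 * (norm (p + t *\<^sub>R q))\<^sup>2 =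
      \<eta> / 2 * ((1 - t) * (norm p)\<^sup>2 + t * (norm (p + q))\<^sup>2 - t * (1 - t) * (norm q)\<^sup>2)"
    by simp
  ultimately show ?thesis
    by (simp add: algebra_simps power2_eq_square diff_divide_distrib add_divide_distrib)
qed

text \<open>Off \<open>C\<close> the difference quotient is infinite and meets every lower bound, so
  only points of \<open>C\<close> constrain \<open>v\<close>. A liminf is nonnegative when each
  \<open>- \<epsilon>\<close> with \<open>\<epsilon> > 0\<close> is eventually a strict lower bound;
  halving \<epsilon> allows the non-strict form.\<close>

lemma frechet_subdiff_indicator_iff:
  "v \<in> frechet_subdiff (\<lambda>z. ereal (f z) + indicator_fn C z) x \<longleftrightarrow>
    x \<in> C \<and> (\<forall>\<epsilon>>0. \<forall>\<^sub>F z in at x. z \<in> C \<longrightarrow> f z - f x - v \<bullet> (z - x) \<ge> - \<epsilon> * norm (z - x))"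
    (is "_ \<longleftrightarrow> _ \<and> ?R")
proof (cases "x \<in> C")
  case True
  define Q where "Q = (\<lambda>z. ((ereal (f z) + indicator_fn C z) - (ereal (f x) + indicator_fn C x)
      - ereal (v \<bullet> (z - x))) / ereal (norm (z - x)))"
  have Q: "Q z = (if z \<in> C then ereal ((f z - f x - v \<bullet> (z - x)) / norm (z - x)) else \<infinity>)"
    if "z \<noteq> x" for z
    using that True by (auto simp: Q_def indicator_fn_def)
  have key: "ereal (- \<epsilon>) < Q z \<longleftrightarrow> (z \<in> C \<longrightarrow> f z - f x - v \<bullet> (z - x) > - \<epsilon> * norm (z - x))"
    if "z \<noteq> x" for z \<epsilon>
    using that by (auto simp: Q field_simps)
  have ev: "(\<forall>\<^sub>F z in at x. ereal (- \<epsilon>) < Q z) \<longleftrightarrow>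
      (\<forall>\<^sub>F z in at x. z \<in> C \<longrightarrow> f z - f x - v \<bullet> (z - x) > - \<epsilon> * norm (z - x))" for \<epsilon>
    by (rule eventually_subst) (use key in \<open>simp add: eventually_at_filter\<close>)
  have "Liminf (at x) Q \<ge> 0 \<longleftrightarrow> (\<forall>\<epsilon>>0. \<forall>\<^sub>F z in at x. ereal (- \<epsilon>) < Q z)"
  proof
    assume "Liminf (at x) Q \<ge> 0"
    then show "\<forall>\<epsilon>>0. \<forall>\<^sub>F z in at x. ereal (- \<epsilon>) < Q z"
      unfolding le_Liminf_iff by auto
  next
    assume *: "\<forall>\<epsilon>>0. \<forall>\<^sub>F z in at x. ereal (- \<epsilon>) < Q z"
    show "Liminf (at x) Q \<ge> 0"
      unfolding le_Liminf_iff
    proof (intro allI impI)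
      fix y :: ereal assume "y < 0"
      then obtain r where r: "y < ereal r" "ereal r < 0"
        using ereal_dense2 by blast
      then have "\<forall>\<^sub>F z in at x. ereal (- (- r)) < Q z"
        using *[rule_format, of "- r"] by simp
      then show "\<forall>\<^sub>F z in at x. y < Q z"
        by eventually_elim (use r in auto)
    qed
  qed
  also have "\<dots> \<longleftrightarrow> (\<forall>\<epsilon>>0. \<forall>\<^sub>F z in at x. z \<in> C \<longrightarrow> f z - f x - v \<bullet> (z - x) > - \<epsilon> * norm (z - x))"
    unfolding ev ..
  also have "\<dots> \<longleftrightarrow> ?R"
  proof (intro iffI allI impI)
    fix \<epsilon> :: real
    assume *: ?R and "\<epsilon> > 0"
    then have "\<forall>\<^sub>F z in at x. z \<in> C \<longrightarrow> f z - f x - v \<bullet> (z - x) \<ge> - (\<epsilon> / 2) * norm (z - x)"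
      using *[THEN spec, of "\<epsilon> / 2"] by (auto simp del: minus_divide_left)
    moreover have "\<forall>\<^sub>F z in at x. z \<noteq> x"
      by (simp add: eventually_at_filter)
    ultimately show "\<forall>\<^sub>F z in at x. z \<in> C \<longrightarrow> f z - f x - v \<bullet> (z - x) > - \<epsilon> * norm (z - x)"
    proof eventually_elim
      case (elim z)
      have "\<epsilon> * norm (z - x) > 0" using elim \<open>\<epsilon> > 0\<close> by simp
      then show ?case using elim by auto
    qed
  qed (auto elim!: eventually_mono)
  finally show ?thesis
    using True by (simp add: frechet_subdiff_def Q_def indicator_fn_def)
qed (simp add: frechet_subdiff_def indicator_fn_def)

lemma frechet_imp_limiting:
  "v \<in> frechet_subdiff J x \<Longrightarrow> v \<in> limiting_subdiff J x"
  unfolding limiting_subdiff_def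
  by (rule CollectI, rule conjI, simp add: frechet_subdiff_def,
      rule exI[of _ "\<lambda>_. x"], rule exI[of _ "\<lambda>_. v"]) simp

section \<open>Tangent directions as test directions for subgradients\<close>

text \<open>At points of \<open>C\<close> these are the derivable tangent vectors of variational
  analysis: one-sided velocities, with no condition on the curve at negative times.\<close>

definition curve_tangent :: "'a::real_normed_vector set \<Rightarrow> 'a \<Rightarrow> 'a \<Rightarrow> bool" where
  "curve_tangent C x u \<longleftrightarrow> (\<exists>c::real \<Rightarrow> 'a. c 0 = x \<and> (c has_vector_derivative u) (at_right 0) \<and>
     (\<forall>\<^sub>F t in at_right 0. c t \<in> C))"

text \<open>Velocities may vary with the base point: this uniformity is what survives the passage
  from Frechet subgradients at nearby points to limiting subgradients.\<close>
definition regular_tangent :: "'a::real_normed_vector set \<Rightarrow> 'a \<Rightarrow> 'a \<Rightarrow> bool" where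
  "regular_tangent C x u \<longleftrightarrow> (\<forall>xs. xs \<longlonglongrightarrow> x \<and> (\<forall>n. xs n \<in> C) \<longrightarrow>
     (\<exists>us. us \<longlonglongrightarrow> u \<and> (\<forall>\<^sub>F n in sequentially. curve_tangent C (xs n) (us n))))"

lemma has_vector_derivative_slope_right:
  assumes "(c has_vector_derivative u) (at_right 0)"
  shows "((\<lambda>t. (c t - c 0) /\<^sub>R t) \<longlongrightarrow> u) (at_right 0)"
proof -
  have "((\<lambda>t. (1 / norm (t - 0)) *\<^sub>R (c t - (c 0 + (t - 0) *\<^sub>R u))) \<longlongrightarrow> 0) (at_right 0)"
    using assms unfolding has_vector_derivative_def has_derivative_within by blast
  then have "((\<lambda>t. (c t - c 0) /\<^sub>R t - u) \<longlongrightarrow> 0) (at_right 0)"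
    by (rule Lim_transform_eventually)
      (auto simp: eventually_at_filter algebra_simps divide_inverse)
  then show ?thesis
    by (simp add: LIM_zero_iff)
qed

text \<open>The subgradient inequality is evaluated along a curve with velocity \<open>u\<close> and
  divided by \<open>t\<close>. The Lipschitz bound replaces \<open>s (c t)\<close> by
  \<open>s x + t *\<^sub>R s' u\<close> at cost o(t), and the chord inequality bounds the remaining
  increment of \<open>g\<close> by \<open>t\<close> times its value for the full step.\<close>

lemma frechet_subdiff_le_model:
  fixes C :: "'a::euclidean_space set" and a' :: "'a \<Rightarrow> real" and s' :: "'a \<Rightarrow> 'z::real_inner"
  assumes a: "(a has_derivative a') (at x)"
    and s: "(s has_derivative s') (at x)"
    and g: "L-lipschitz_on UNIV g" "weakly_convex \<eta> g" "\<eta> \<ge> 0"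
    and v: "v \<in> frechet_subdiff (\<lambda>z. ereal (a z + g (s z)) + indicator_fn C z) x"
    and u: "curve_tangent C x u"
  shows "v \<bullet> u \<le> a' u + (g (s x + s' u) - g (s x) + \<eta> / 2 * (norm (s' u))\<^sup>2)"
proof -
  obtain c where c: "c 0 = x" "(c has_vector_derivative u) (at_right 0)" "\<forall>\<^sub>F t in at_right 0. c t \<in> C"
    using u by (auto simp: curve_tangent_def)
  note c' = has_vector_derivative_slope_right[OF c(2), unfolded c(1)]
  have chain: "((\<lambda>t. (f (c t) - f x) /\<^sub>R t) \<longlongrightarrow> f' u) (at_right 0)"
    if "(f has_derivative f') (at x)" for f :: "'a \<Rightarrow> 'w::real_normed_vector" and f'
  proof -
    have "((\<lambda>t. f (c t)) has_derivative (\<lambda>t. f' (t *\<^sub>R u))) (at_right 0)"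
      using has_derivative_compose[OF c(2)[unfolded has_vector_derivative_def], of f f'] that c(1) by simp
    moreover have "(\<lambda>t. f' (t *\<^sub>R u)) = (\<lambda>t. t *\<^sub>R f' u)"
      using has_derivative_linear[OF that] by (simp add: linear_scale)
    ultimately have "((\<lambda>t. f (c t)) has_vector_derivative f' u) (at_right 0)"
      by (simp add: has_vector_derivative_def)
    from has_vector_derivative_slope_right[OF this] show ?thesis by (simp add: c(1))
  qed
  have ctend: "(c \<longlongrightarrow> x) (at_right 0)"
    using has_derivative_continuous[OF c(2)[unfolded has_vector_derivative_def]] c(1)
    by (simp add: continuous_within)
  define l where "l = g (s x + s' u) - g (s x) + \<eta> / 2 * (norm (s' u))\<^sup>2"
  \<comment> \<open>The slack \<open>\<epsilon> * norm (z - x)\<close> of the subgradient inequality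
    becomes \<open>\<epsilon> * norm u\<close> after division by \<open>t\<close>; it is removed at
    the end by letting \<epsilon> tend to 0.\<close>
  have "v \<bullet> u \<le> a' u + l + \<epsilon> * norm u" if "\<epsilon> > 0" for \<epsilon>
  proof (rule tendsto_le[OF trivial_limit_at_right_real])
    show "((\<lambda>t. v \<bullet> ((c t - x) /\<^sub>R t)) \<longlongrightarrow> v \<bullet> u) (at_right 0)"
      by (intro tendsto_intros c')
    have "((\<lambda>t. (a (c t) - a x) /\<^sub>R t + l + L * norm ((s (c t) - s x) /\<^sub>R t - s' u)
            + \<epsilon> * norm ((c t - x) /\<^sub>R t))
        \<longlongrightarrow> a' u + l + L * norm (s' u - s' u) + \<epsilon> * norm u) (at_right 0)"
      by (intro tendsto_intros c' chain a s)
    then show "((\<lambda>t. (a (c t) - a x) /\<^sub>R t + l + L * norm ((s (c t) - s x) /\<^sub>R t - s' u)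
            + \<epsilon> * norm ((c t - x) /\<^sub>R t))
        \<longlongrightarrow> a' u + l + \<epsilon> * norm u) (at_right 0)"
      by simp
    have "\<forall>\<^sub>F z in at x. z \<in> C \<longrightarrow>
        (a z + g (s z)) - (a x + g (s x)) - v \<bullet> (z - x) \<ge> - \<epsilon> * norm (z - x)"
      using v \<open>\<epsilon> > 0\<close> unfolding frechet_subdiff_indicator_iff by blast
    \<comment> \<open>The curve may return to \<open>x\<close> at positive times, so the punctured
      neighbourhood is filled in; at \<open>z = x\<close> both sides are 0.\<close>
    then have "\<forall>\<^sub>F z in nhds x. z \<in> C \<longrightarrow>
        (a z + g (s z)) - (a x + g (s x)) - v \<bullet> (z - x) \<ge> - \<epsilon> * norm (z - x)"
      unfolding eventually_at_filter by eventually_elim auto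
    from eventually_compose_filterlim[OF this ctend]
    have "\<forall>\<^sub>F t in at_right 0. c t \<in> C \<longrightarrow>
        (a (c t) + g (s (c t))) - (a x + g (s x)) - v \<bullet> (c t - x) \<ge> - \<epsilon> * norm (c t - x)" .
    moreover have "\<forall>\<^sub>F t in at_right 0. t < (1::real)" "\<forall>\<^sub>F t in at_right 0. t > (0::real)"
      using eventually_at_right_real[of 0 1] by (auto elim: eventually_mono)
    ultimately show "\<forall>\<^sub>F t in at_right 0. v \<bullet> ((c t - x) /\<^sub>R t) \<le>
        (a (c t) - a x) /\<^sub>R t + l + L * norm ((s (c t) - s x) /\<^sub>R t - s' u)
            + \<epsilon> * norm ((c t - x) /\<^sub>R t)"
      using c(3)
    proof eventually_elim
      case (elim t)
      have "g (s (c t)) - g (s x + t *\<^sub>R s' u) \<le> L * norm (s (c t) - (s x + t *\<^sub>R s' u))"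
        using lipschitz_onD[OF g(1), of "s (c t)" "s x + t *\<^sub>R s' u"] by (auto simp: dist_norm)
      also have "s (c t) - (s x + t *\<^sub>R s' u) = t *\<^sub>R ((s (c t) - s x) /\<^sub>R t - s' u)"
        using elim by (simp add: algebra_simps)
      also have "norm \<dots> = t * norm ((s (c t) - s x) /\<^sub>R t - s' u)"
        using elim by simp
      finally have 1: "g (s (c t)) - g (s x + t *\<^sub>R s' u) \<le> t * (L * norm ((s (c t) - s x) /\<^sub>R t - s' u))"
        by (simp add: mult_ac)
      \<comment> \<open>Nonnegativity of \<eta> lets the negative quadratic term of the chord
        inequality be dropped.\<close>
      have "0 \<le> \<eta> / 2 * t\<^sup>2 * (norm (s' u))\<^sup>2" using g(3) by simp
      then have 2: "g (s x + t *\<^sub>R s' u) - g (s x) \<le> t * l"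
        using weakly_convex_chord[OF g(2), of t "s x" "s' u"] elim by (simp add: l_def)
      have 3: "norm (c t - x) = t * norm ((c t - x) /\<^sub>R t)" "v \<bullet> (c t - x) = t * (v \<bullet> ((c t - x) /\<^sub>R t))"
        "a (c t) - a x = t * ((a (c t) - a x) /\<^sub>R t)"
        using elim by auto
      have "t * (v \<bullet> ((c t - x) /\<^sub>R t)) \<le> t * ((a (c t) - a x) /\<^sub>R t + l
            + L * norm ((s (c t) - s x) /\<^sub>R t - s' u) + \<epsilon> * norm ((c t - x) /\<^sub>R t))"
        unfolding distrib_left mult.left_commute[of t \<epsilon>] 3(1)[symmetric] 3(2)[symmetric] 3(3)[symmetric]
        using elim 1 2 by (simp add: algebra_simps)
      then show ?case using elim by (simp add: mult_le_cancel_left_pos)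
    qed
  qed
  then have "\<forall>\<^sub>F \<epsilon> in at_right 0. v \<bullet> u \<le> a' u + l + \<epsilon> * norm u"
    by (simp add: eventually_at_filter)
  moreover have "((\<lambda>\<epsilon>. a' u + l + \<epsilon> * norm u) \<longlongrightarrow> a' u + l + 0 * norm u) (at_right 0)"
    by (intro tendsto_intros)
  ultimately have "v \<bullet> u \<le> a' u + l + 0 * norm u"
    using tendsto_lowerbound trivial_limit_at_right_real by blast
  then show ?thesis by (simp add: l_def)
qed

text \<open>The Frechet bound holds at the approximating points \<open>xs n\<close> along velocities
  \<open>us n\<close> tending to \<open>u\<close>. Both sides converge, because the derivatives are
  continuous at \<open>x\<close> and \<open>g\<close> is continuous.\<close>

lemma limiting_subdiff_le_model:
  fixes C :: "'a::euclidean_space set" and a' :: "'a \<Rightarrow> 'a \<Rightarrow>\<^sub>L real"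
    and s' :: "'a \<Rightarrow> 'a \<Rightarrow>\<^sub>L 'z::real_inner"
  assumes a: "\<And>x. (a has_derivative a' x) (at x)" "isCont a' x"
    and s: "\<And>x. (s has_derivative s' x) (at x)" "isCont s' x"
    and g: "L-lipschitz_on UNIV g" "weakly_convex \<eta> g" "\<eta> \<ge> 0"
    and v: "v \<in> limiting_subdiff (\<lambda>z. ereal (a z + g (s z)) + indicator_fn C z) x"
    and u: "regular_tangent C x u"
  shows "v \<bullet> u \<le> a' x u + (g (s x + s' x u) - g (s x) + \<eta> / 2 * (norm (s' x u))\<^sup>2)"
proof -
  obtain xs vs where xs: "xs \<longlonglongrightarrow> x" "vs \<longlonglongrightarrow> v"
    and vs: "\<And>n. vs n \<in> frechet_subdiff (\<lambda>z. ereal (a z + g (s z)) + indicator_fn C z) (xs n)"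
    using v by (auto simp: limiting_subdiff_def)
  have "xs n \<in> C" for n
    using vs[of n] by (simp add: frechet_subdiff_indicator_iff)
  then obtain us where us: "us \<longlonglongrightarrow> u" "\<forall>\<^sub>F n in sequentially. curve_tangent C (xs n) (us n)"
    using u xs(1) unfolding regular_tangent_def by blast
  have cont: "isCont s x" "\<And>p. isCont g p"
    using has_derivative_continuous[OF s(1)] lipschitz_on_continuous_on[OF g(1)]
    by (auto simp: continuous_on_eq_continuous_at)
  have lims: "(\<lambda>n. a' (xs n)) \<longlonglongrightarrow> a' x" "(\<lambda>n. s' (xs n)) \<longlonglongrightarrow> s' x" "(\<lambda>n. s (xs n)) \<longlonglongrightarrow> s x"
    using isCont_tendsto_compose xs(1) a(2) s(2) cont(1) by blast+
  have s'u: "(\<lambda>n. s' (xs n) (us n)) \<longlonglongrightarrow> s' x u"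
    by (intro tendsto_intros lims us)
  show ?thesis
  proof (rule tendsto_le[OF trivial_limit_sequentially])
    show "(\<lambda>n. vs n \<bullet> us n) \<longlonglongrightarrow> v \<bullet> u"
      by (intro tendsto_intros xs us)
    show "(\<lambda>n. a' (xs n) (us n) + (g (s (xs n) + s' (xs n) (us n)) - g (s (xs n))
        + \<eta> / 2 * (norm (s' (xs n) (us n)))\<^sup>2)) \<longlonglongrightarrow>
      a' x u + (g (s x + s' x u) - g (s x) + \<eta> / 2 * (norm (s' x u))\<^sup>2)"
      by (intro tendsto_intros lims us s'u isCont_tendsto_compose[OF cont(2)])
    show "\<forall>\<^sub>F n in sequentially. vs n \<bullet> us n \<le>
      a' (xs n) (us n) + (g (s (xs n) + s' (xs n) (us n)) - g (s (xs n))
        + \<eta> / 2 * (norm (s' (xs n) (us n)))\<^sup>2)"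
      using us(2) by eventually_elim (rule frechet_subdiff_le_model[OF a(1) s(1) g vs])
  qed
qed

section \<open>Sufficiency of the model condition and the stationarity criterion\<close>

text \<open>A point \<open>z\<close> of \<open>C\<close> is compared with \<open>x + u\<close> for a
  nearby \<open>u\<close> in \<open>K\<close>. The first-order errors of \<open>a\<close>,
  \<open>s\<close> and \<open>u\<close>, together with the quadratic term of the model, total at
  most a constant times \<open>\<delta> * norm (z - x)\<close>.\<close>

lemma frechet_subdiff_zeroI:
  fixes C :: "'a::euclidean_space set" and a' :: "'a \<Rightarrow>\<^sub>L real"
    and s' :: "'a \<Rightarrow>\<^sub>L 'z::real_inner"
  assumes a: "(a has_derivative a') (at x)"
    and s: "(s has_derivative s') (at x)"
    and g: "L-lipschitz_on UNIV g" "\<eta> \<ge> 0"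
    and "x \<in> C"
    and K: "\<And>\<epsilon>. \<epsilon> > 0 \<Longrightarrow> \<forall>\<^sub>F z in at x. z \<in> C \<longrightarrow> (\<exists>u\<in>K. norm (z - x - u) \<le> \<epsilon> * norm (z - x))"
    and stat: "\<And>u. u \<in> K \<Longrightarrow> 0 \<le> a' u + (g (s x + s' u) - g (s x) + \<eta> / 2 * (norm (s' u))\<^sup>2)"
  shows "0 \<in> frechet_subdiff (\<lambda>z. ereal (a z + g (s z)) + indicator_fn C z) x"
  unfolding frechet_subdiff_indicator_iff
proof (intro conjI allI impI \<open>x \<in> C\<close>)
  fix \<epsilon> :: real assume "\<epsilon> > 0"
  have L: "L \<ge> 0" using g(1) lipschitz_on_nonneg by blast
  \<comment> \<open>The summands collect the error in \<open>a\<close>, the error in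
    \<open>g\<close> after \<open>s\<close>, and the quadratic term, whose factor 2 is \<eta>/2
    times the 4 coming from \<open>norm u \<le> 2 * r\<close>.\<close>
  define M where "M = 1 + norm a' + L * (1 + norm s') + 2 * \<eta> * (norm s')\<^sup>2"
  have M: "M > 0" unfolding M_def using L g(2) by (intro add_pos_nonneg) auto
  define \<delta> where "\<delta> = min 1 (\<epsilon> / M)"
  have \<delta>: "\<delta> > 0" "\<delta> \<le> 1" "M * \<delta> \<le> \<epsilon>"
    using M \<open>\<epsilon> > 0\<close> by (auto simp: \<delta>_def min_def field_simps)
  have approx: "\<forall>\<^sub>F z in at x. norm (f z - f x - f' (z - x)) \<le> \<delta> * norm (z - x)"
    if "(f has_derivative f') (at x)" for f :: "'a \<Rightarrow> 'w::real_normed_vector" and f'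
    using that \<delta>(1) unfolding has_derivative_at_alt eventually_at
    by (metis dist_norm)
  \<comment> \<open>Using \<delta> also as a radius gives \<open>r * r \<le> \<delta> * r\<close>,
    so the quadratic term is as small as the linear errors.\<close>
  have "\<forall>\<^sub>F z in at x. dist z x < \<delta>"
    using \<delta>(1) unfolding eventually_at by blast
  with K[OF \<delta>(1)] approx[OF a] approx[OF s]
  show "\<forall>\<^sub>F z in at x. z \<in> C \<longrightarrow>
      - \<epsilon> * norm (z - x) \<le> a z + g (s z) - (a x + g (s x)) - 0 \<bullet> (z - x)"
  proof eventually_elim
    case (elim z)
    show ?case
    proof
      assume "z \<in> C"
      then obtain u where u: "u \<in> K" "norm (z - x - u) \<le> \<delta> * norm (z - x)"
        using elim by blast
      define r where "r = norm (z - x)"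
      have r: "r \<ge> 0" "r \<le> \<delta>" using elim by (auto simp: r_def dist_norm)
      have "norm u \<le> norm (z - x) + norm (z - x - u)"
        by (metis norm_triangle_sub norm_minus_commute add.commute)
      also have "\<dots> \<le> r + \<delta> * r" using u by (simp add: r_def)
      also have "\<dots> \<le> 2 * r" using r \<delta> mult_right_mono[of \<delta> 1 r] by simp
      finally have "norm u \<le> 2 * r" .
      have "(norm u)\<^sup>2 \<le> (2 * r)\<^sup>2"
        using \<open>norm u \<le> 2 * r\<close> by (intro power_mono) auto
      also have "\<dots> = 4 * (r * r)" by (simp add: power2_eq_square)
      also have "\<dots> \<le> 4 * (\<delta> * r)" using r by (intro mult_left_mono mult_right_mono) auto
      finally have u2: "(norm u)\<^sup>2 \<le> 4 * (\<delta> * r)" .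
      have "(norm (s' u))\<^sup>2 \<le> (norm s' * norm u)\<^sup>2"
        by (intro power_mono norm_blinfun) auto
      also have "\<dots> \<le> (norm s')\<^sup>2 * (4 * (\<delta> * r))"
        unfolding power_mult_distrib by (intro mult_left_mono u2) auto
      finally have q: "\<eta> / 2 * (norm (s' u))\<^sup>2 \<le> \<eta> / 2 * ((norm s')\<^sup>2 * (4 * (\<delta> * r)))"
        using g(2) by (intro mult_left_mono) auto
      have lin: "norm (f' (z - x - u)) \<le> norm f' * (\<delta> * r)"
        for f' :: "'a \<Rightarrow>\<^sub>L 'w::real_normed_vector"
        using norm_blinfun[of f' "z - x - u"] mult_left_mono[OF u(2), of "norm f'"]
        by (simp add: r_def)
      have A: "a z - a x - a' u \<ge> - (1 + norm a') * (\<delta> * r)"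
        using elim(2) lin[of a'] by (simp add: r_def blinfun.diff_right left_diff_distrib)
      have "norm (s z - (s x + s' u)) \<le> norm (s z - s x - s' (z - x)) + norm (s' (z - x - u))"
        using norm_triangle_ineq[of "s z - s x - s' (z - x)" "s' (z - x - u)"]
        by (simp add: algebra_simps blinfun.diff_right blinfun.add_right)
      also have "\<dots> \<le> (1 + norm s') * (\<delta> * r)"
        using add_mono[OF elim(3) lin[of s']] by (simp add: r_def distrib_right)
      finally have S: "norm (s z - (s x + s' u)) \<le> (1 + norm s') * (\<delta> * r)" .
      have "g (s z) - g (s x + s' u) \<ge> - L * norm (s z - (s x + s' u))"
        using lipschitz_onD[OF g(1), of "s z" "s x + s' u"] by (auto simp: dist_norm)
      with mult_left_mono[OF S L]
      have G: "g (s z) - g (s x + s' u) \<ge> - (L * ((1 + norm s') * (\<delta> * r)))"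
        by simp
      have "M * (\<delta> * r) = (1 + norm a') * (\<delta> * r) + L * ((1 + norm s') * (\<delta> * r))
          + \<eta> / 2 * ((norm s')\<^sup>2 * (4 * (\<delta> * r)))"
        by (simp add: M_def algebra_simps)
      with stat[OF u(1)] A G q
      have "a z + g (s z) - (a x + g (s x)) \<ge> - (M * (\<delta> * r))"
        by linarith
      moreover have "M * (\<delta> * r) \<le> \<epsilon> * r"
        using mult_right_mono[OF \<delta>(3) r(1)] by (simp add: mult_ac)
      ultimately show "- \<epsilon> * norm (z - x) \<le> a z + g (s z) - (a x + g (s x)) - 0 \<bullet> (z - x)"
        by (simp add: r_def)
    qed
  qed
qed

text \<open>The two conditions on \<open>K\<close> serve opposite directions: regular tangency makes
  the model inequality necessary, and first-order approximation of \<open>C\<close> by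
  \<open>x + K\<close> makes it sufficient, even for a Frechet subgradient.\<close>

lemma zero_limiting_subdiff_iff:
  fixes C :: "'a::euclidean_space set" and a' :: "'a \<Rightarrow> 'a \<Rightarrow>\<^sub>L real"
    and s' :: "'a \<Rightarrow> 'a \<Rightarrow>\<^sub>L 'z::real_inner"
  assumes a: "\<And>x. (a has_derivative a' x) (at x)" "isCont a' x"
    and s: "\<And>x. (s has_derivative s' x) (at x)" "isCont s' x"
    and g: "L-lipschitz_on UNIV g" "weakly_convex \<eta> g" "\<eta> \<ge> 0"
    and "x \<in> C"
    and K: "\<And>u. u \<in> K \<Longrightarrow> regular_tangent C x u"
      "\<And>\<epsilon>. \<epsilon> > 0 \<Longrightarrow> \<forall>\<^sub>F z in at x. z \<in> C \<longrightarrow> (\<exists>u\<in>K. norm (z - x - u) \<le> \<epsilon> * norm (z - x))"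
  shows "0 \<in> limiting_subdiff (\<lambda>z. ereal (a z + g (s z)) + indicator_fn C z) x \<longleftrightarrow>
    (\<forall>u\<in>K. 0 \<le> a' x u + (g (s x + s' x u) - g (s x) + \<eta> / 2 * (norm (s' x u))\<^sup>2))"
proof (intro iffI ballI)
  fix u assume "0 \<in> limiting_subdiff (\<lambda>z. ereal (a z + g (s z)) + indicator_fn C z) x" "u \<in> K"
  from limiting_subdiff_le_model[OF a s g this(1) K(1)[OF this(2)]]
  show "0 \<le> a' x u + (g (s x + s' x u) - g (s x) + \<eta> / 2 * (norm (s' x u))\<^sup>2)"
    by simp
next
  assume "\<forall>u\<in>K. 0 \<le> a' x u + (g (s x + s' x u) - g (s x) + \<eta> / 2 * (norm (s' x u))\<^sup>2)"
  then show "0 \<in> limiting_subdiff (\<lambda>z. ereal (a z + g (s z)) + indicator_fn C z) x"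
    by (intro frechet_imp_limiting frechet_subdiff_zeroI[OF a(1) s(1) g(1,3) \<open>x \<in> C\<close> K(2)]) auto
qed

section \<open>Normal vectors, and tangents of the whole space\<close>

text \<open>This is the model bound with zero data and \<open>\<eta> = 0\<close>, for which the
  model vanishes.\<close>

lemma normal_cone_regular_tangent:
  assumes v: "v \<in> normal_cone C x" and u: "regular_tangent C x u"
  shows "v \<bullet> u \<le> 0"
proof -
  \<comment> \<open>The unreduced application displays the zero function in the shape
    \<open>a z + g (s z)\<close>, with \<open>g\<close> defined on the reals.\<close>
  have "indicator_fn C = (\<lambda>z. ereal (0 + (\<lambda>_::real. 0::real) 0) + indicator_fn C z)"
    by (auto simp: indicator_fn_def)
  then have v': "v \<in> limiting_subdiff (\<lambda>z. ereal (0 + (\<lambda>_::real. 0::real) 0) + indicator_fn C z) x"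
    using v unfolding normal_cone_def by metis
  have d: "((\<lambda>_. 0::real) has_derivative blinfun_apply 0) (at z)" for z :: 'a
    using has_derivative_const[of "0::real" "at z"] by (simp add: zero_blinfun.rep_eq)
  have "weakly_convex 0 (\<lambda>_::real. 0)"
    by (simp add: weakly_convex_def convex_on_def)
  moreover have "0-lipschitz_on UNIV (\<lambda>_::real. 0::real)"
    by (simp add: lipschitz_on_def)
  ultimately show ?thesis
    using limiting_subdiff_le_model[where a = "\<lambda>_. 0" and s = "\<lambda>_. 0" and g = "\<lambda>_. 0"
        and a' = "\<lambda>_. 0" and s' = "\<lambda>_. 0" and L = 0 and \<eta> = 0,
        OF d _ d _ _ _ _ v' u] by simp
qed

lemma regular_tangent_UNIV: "regular_tangent UNIV x u"
proof -
  have "curve_tangent UNIV y u" for y :: 'a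
    unfolding curve_tangent_def
    by (rule exI[of _ "\<lambda>t. y + t *\<^sub>R u"]) (auto intro!: derivative_eq_intros)
  then show ?thesis
    unfolding regular_tangent_def by (auto intro!: exI[of _ "\<lambda>_. u"])
qed

section \<open>Local geometry of an embedded submanifold\<close>

text \<open>In the chart \<Phi> the set is a piece of the kernel of \<open>H' x\<close>, so \<Psi>
  carries short segments from \<open>\<Phi> z\<close> in direction \<open>u\<close> to curves in
  \<open>C\<close>. Their velocities are the inverse of \<open>\<Phi>' z\<close> applied to
  \<open>u\<close>, and \<open>\<Phi>' z\<close> tends to the identity as \<open>z\<close> tends to
  \<open>x\<close>; this supplies the required uniformity.\<close>

lemma regular_tangent_submersion_kernel:
  fixes H :: "'a::euclidean_space \<Rightarrow> 'a" and H' :: "'a \<Rightarrow> 'a \<Rightarrow>\<^sub>L 'a" and B :: "'a \<Rightarrow>\<^sub>L 'a"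
  assumes N: "open N" "x \<in> N" and CN: "C \<inter> N = {z \<in> N. H z = 0}"
    and H: "\<And>z. z \<in> N \<Longrightarrow> (H has_derivative H' z) (at z)" "continuous_on N H'"
    and B: "\<And>z. z \<in> N \<Longrightarrow> H' x (B (H z)) = H z" "\<And>w. H' x (B (H' x w)) = H' x w"
    and u: "H' x u = 0"
  shows "regular_tangent C x u"
  unfolding regular_tangent_def
proof (intro allI impI)
  fix xs assume "xs \<longlonglongrightarrow> x \<and> (\<forall>n. xs n \<in> C)"
  then have xs: "xs \<longlonglongrightarrow> x" "\<And>n. xs n \<in> C" by auto
  define \<Phi> where "\<Phi> z = z + B (H z - H' x z)" for z
  define \<Phi>' where "\<Phi>' z = id_blinfun + (B o\<^sub>L (H' z - H' x))" for z
  have H_eq: "H z = H' x (\<Phi> z)" if "z \<in> N" for z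
    using B that by (simp add: \<Phi>_def blinfun.bilinear_simps)
  have d\<Phi>: "(\<Phi> has_derivative \<Phi>' z) (at z)" if "z \<in> N" for z
  proof -
    have "(\<Phi> has_derivative (\<lambda>w. w + B (H' z w - H' x w))) (at z)"
      unfolding \<Phi>_def[abs_def]
      by (intro has_derivative_add has_derivative_ident has_derivative_diff H(1) that
          bounded_linear.has_derivative[OF blinfun.bounded_linear_right]
          bounded_linear_imp_has_derivative blinfun.bounded_linear_right)
    moreover have "(\<lambda>w. w + B (H' z w - H' x w)) = \<Phi>' z"
      by (simp add: fun_eq_iff \<Phi>'_def blinfun.bilinear_simps)
    ultimately show ?thesis by simp
  qed
  have c\<Phi>: "continuous_on N \<Phi>'"
    unfolding \<Phi>'_def by (intro continuous_intros H(2))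
  \<comment> \<open>The correction in \<open>\<Phi>'\<close> vanishes at \<open>x\<close>, so the
    identity is the inverse that the inverse function theorem asks for.\<close>
  have "id_blinfun o\<^sub>L \<Phi>' x = id_blinfun"
    by (intro blinfun_eqI) (simp add: \<Phi>'_def blinfun.bilinear_simps)
  from inverse_function_theorem[OF N(1) d\<Phi> c\<Phi> N(2) this]
  obtain U V \<Psi> \<Psi>' where U: "open U" "U \<subseteq> N" "x \<in> U" and V: "open V"
    and hom: "homeomorphism U V \<Phi> \<Psi>"
    and d\<Psi>: "\<And>y. y \<in> V \<Longrightarrow> (\<Psi> has_derivative \<Psi>' y) (at y)"
      "\<And>y. y \<in> V \<Longrightarrow> \<Psi>' y = inv (\<Phi>' (\<Psi> y))" "\<And>y. y \<in> V \<Longrightarrow> bij (\<Phi>' (\<Psi> y))"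
    by metis
  define us where "us n = \<Psi>' (\<Phi> (xs n)) u" for n
  have xsU: "\<forall>\<^sub>F n in sequentially. xs n \<in> U"
    using xs(1) U by (metis topological_tendstoD)
  have tangent: "curve_tangent C z (\<Psi>' (\<Phi> z) u)" if z: "z \<in> C" "z \<in> U" for z
    unfolding curve_tangent_def
  proof (intro exI conjI)
    have \<Phi>z: "\<Phi> z \<in> V" "\<Psi> (\<Phi> z) = z"
      using hom z by (auto simp: homeomorphism_def)
    then show "\<Psi> (\<Phi> z + 0 *\<^sub>R u) = z" by simp
    have "((\<lambda>t. \<Phi> z + t *\<^sub>R u) has_derivative (\<lambda>t. t *\<^sub>R u)) (at_right 0)"
      by (auto intro!: derivative_eq_intros)
    from has_derivative_compose[OF this, of \<Psi> "\<Psi>' (\<Phi> z)"] d\<Psi>(1)[OF \<Phi>z(1)]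
    have "((\<lambda>t. \<Psi> (\<Phi> z + t *\<^sub>R u)) has_derivative (\<lambda>t. \<Psi>' (\<Phi> z) (t *\<^sub>R u))) (at_right 0)"
      by simp
    moreover have "\<Psi>' (\<Phi> z) (t *\<^sub>R u) = t *\<^sub>R \<Psi>' (\<Phi> z) u" for t
      using has_derivative_linear[OF d\<Psi>(1)[OF \<Phi>z(1)]] by (simp add: linear_scale)
    ultimately show "((\<lambda>t. \<Psi> (\<Phi> z + t *\<^sub>R u)) has_vector_derivative \<Psi>' (\<Phi> z) u) (at_right 0)"
      by (simp add: has_vector_derivative_def)
    have "((\<lambda>t. \<Phi> z + t *\<^sub>R u) \<longlongrightarrow> \<Phi> z + 0 *\<^sub>R u) (at_right 0)"
      by (intro tendsto_intros)
    then have "\<forall>\<^sub>F t in at_right 0. \<Phi> z + t *\<^sub>R u \<in> V"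
      using V \<Phi>z(1) by (auto dest: topological_tendstoD)
    then show "\<forall>\<^sub>F t in at_right 0. \<Psi> (\<Phi> z + t *\<^sub>R u) \<in> C"
    proof eventually_elim
      case (elim t)
      then have w: "\<Psi> (\<Phi> z + t *\<^sub>R u) \<in> N" "\<Phi> (\<Psi> (\<Phi> z + t *\<^sub>R u)) = \<Phi> z + t *\<^sub>R u"
        using hom U(2) by (auto simp: homeomorphism_def)
      \<comment> \<open>Both \<open>\<Phi> z\<close> and \<open>u\<close> lie in the kernel of
        \<open>H' x\<close>, hence so does the segment, and the factorization of \<open>H\<close>
        through \<Phi> returns this to \<open>H = 0\<close>.\<close>
      have "z \<in> C \<inter> N" using z U(2) by blast
      then have "H' x (\<Phi> z) = 0"
        unfolding CN by (simp flip: H_eq)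
      then have "H (\<Psi> (\<Phi> z + t *\<^sub>R u)) = 0"
        using H_eq[OF w(1)] w(2) u by (simp add: blinfun.bilinear_simps)
      with w(1) CN show ?case by blast
    qed
  qed
  have "isCont \<Phi>' x"
    using c\<Phi> N by (simp add: continuous_on_eq_continuous_at)
  then have "(\<lambda>n. \<Phi>' (xs n)) \<longlonglongrightarrow> id_blinfun"
    using isCont_tendsto_compose[OF _ xs(1), of \<Phi>'] by (simp add: \<Phi>'_def)
  then have "(\<lambda>n. norm (id_blinfun - \<Phi>' (xs n))) \<longlonglongrightarrow> norm (id_blinfun - id_blinfun :: 'a \<Rightarrow>\<^sub>L 'a)"
    by (intro tendsto_intros)
  then have lim: "(\<lambda>n. norm (id_blinfun - \<Phi>' (xs n))) \<longlonglongrightarrow> 0" by simp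
  have small: "\<forall>\<^sub>F n in sequentially. norm (id_blinfun - \<Phi>' (xs n)) < 1 / 2"
    by (rule order_tendstoD(2)[OF lim]) simp
  \<comment> \<open>Since \<open>\<Phi>' (xs n)\<close> maps \<open>us n\<close> to
    \<open>u\<close>, the difference is \<open>id_blinfun - \<Phi>' (xs n)\<close> applied to
    \<open>us n\<close>. Once that operator has norm below 1/2, \<open>us n\<close> is bounded by
    \<open>2 * norm u\<close>.\<close>
  have "(\<lambda>n. us n - u) \<longlonglongrightarrow> 0"
  proof (rule Lim_null_comparison)
    show "(\<lambda>n. norm (id_blinfun - \<Phi>' (xs n)) * (2 * norm u)) \<longlonglongrightarrow> 0"
      using lim by (rule tendsto_mult_left_zero)
    show "\<forall>\<^sub>F n in sequentially. norm (us n - u) \<le> norm (id_blinfun - \<Phi>' (xs n)) * (2 * norm u)"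
      using xsU small
    proof eventually_elim
      case (elim n)
      define W where "W = \<Phi>' (xs n)"
      have "\<Phi> (xs n) \<in> V" "\<Psi> (\<Phi> (xs n)) = xs n"
        using hom elim by (auto simp: homeomorphism_def)
      with d\<Psi>(2,3) have "W (us n) = u"
        unfolding us_def W_def by (metis bij_inv_eq_iff)
      then have "us n - u = (id_blinfun - W) (us n)"
        by (simp add: blinfun.bilinear_simps)
      then have le: "norm (us n - u) \<le> norm (id_blinfun - W) * norm (us n)"
        by (metis norm_blinfun)
      also have "\<dots> \<le> 1 / 2 * norm (us n)"
        using elim by (intro mult_right_mono) (auto simp: W_def)
      finally have "norm (us n) \<le> 2 * norm u"
        using norm_triangle_sub[of "us n" u] by simp
      then have "norm (id_blinfun - W) * norm (us n) \<le> norm (id_blinfun - W) * (2 * norm u)"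
        by (rule mult_left_mono) simp
      with le show ?case by (simp add: W_def)
    qed
  qed
  then have "us \<longlonglongrightarrow> u" by (simp add: LIM_zero_iff)
  moreover have "\<forall>\<^sub>F n in sequentially. curve_tangent C (xs n) (us n)"
    using xsU by eventually_elim (simp add: us_def tangent xs(2))
  ultimately show "\<exists>us. us \<longlonglongrightarrow> u \<and> (\<forall>\<^sub>F n in sequentially. curve_tangent C (xs n) (us n))"
    by blast
qed

text \<open>The witness is \<open>z - x\<close> minus its image under \<open>B\<close> after
  \<open>A\<close>, a projection onto the kernel of \<open>A\<close>. The removed part is small
  because \<open>H\<close> vanishes at both \<open>z\<close> and \<open>x\<close>, which makes
  \<open>A (z - x)\<close> of order o(|z - x|).\<close>

lemma submersion_kernel_approx:
  fixes B :: "'a::real_normed_vector \<Rightarrow>\<^sub>L 'a" and A :: "'a \<Rightarrow>\<^sub>L 'a"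
  assumes N: "open N" "x \<in> N" and H0: "\<And>z. z \<in> C \<inter> N \<Longrightarrow> H z = 0"
    and "x \<in> C"
    and H: "(H has_derivative A) (at x)"
    and B: "\<And>w. A (B (A w)) = A w"
    and "\<epsilon> > 0"
  shows "\<forall>\<^sub>F z in at x. z \<in> C \<longrightarrow> (\<exists>u. A u = 0 \<and> norm (z - x - u) \<le> \<epsilon> * norm (z - x))"
proof -
  \<comment> \<open>The added 1 keeps the quotient meaningful when \<open>B\<close> is zero.\<close>
  define \<delta> where "\<delta> = \<epsilon> / (norm B + 1)"
  have B1: "norm B + 1 > 0" by (simp add: add_nonneg_pos)
  then have \<delta>: "\<delta> > 0" "norm B * \<delta> \<le> \<epsilon>"
    using \<open>\<epsilon> > 0\<close> by (auto simp: \<delta>_def field_simps)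
  have "\<forall>\<^sub>F z in at x. norm (H z - H x - A (z - x)) \<le> \<delta> * norm (z - x)"
    using H \<delta>(1) unfolding has_derivative_at_alt eventually_at by (metis dist_norm)
  moreover have "\<forall>\<^sub>F z in at x. z \<in> N"
    using N by (simp add: eventually_at_in_open')
  ultimately show ?thesis
  proof eventually_elim
    case (elim z)
    show ?case
    proof (intro impI exI conjI)
      assume "z \<in> C"
      show "A (z - x - B (A (z - x))) = 0"
        using B[of "z - x"] by (simp add: blinfun.diff_right)
      have "norm (A (z - x)) \<le> \<delta> * norm (z - x)"
        using elim H0[of z] H0[of x] \<open>z \<in> C\<close> \<open>x \<in> C\<close> N by simp
      then have "norm (B (A (z - x))) \<le> norm B * (\<delta> * norm (z - x))"
        by (meson norm_blinfun order_trans mult_left_mono norm_ge_zero)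
      also have "\<dots> \<le> \<epsilon> * norm (z - x)"
        using mult_right_mono[OF \<delta>(2), of "norm (z - x)"] by (simp add: mult_ac)
      finally show "norm (z - x - (z - x - B (A (z - x)))) \<le> \<epsilon> * norm (z - x)"
        by simp
    qed
  qed
qed

text \<open>The rank condition identifies the range of the derivative with \<open>E\<close>. As
  \<open>H\<close> takes its values in \<open>E\<close> near \<open>x\<close>, a linear right
  inverse on that range meets both conditions on \<open>B\<close> in the two preceding
  lemmas.\<close>

lemma embedded_submanifold_kernel:
  fixes C :: "'a::euclidean_space set"
  assumes "embedded_submanifold d C" "x \<in> C"
  obtains N and H A :: "'a \<Rightarrow> 'a" where "open N" "x \<in> N" "(H has_derivative A) (at x)" "\<forall>z\<in>C \<inter> N. H z = 0"
    "\<forall>u. A u = 0 \<longrightarrow> regular_tangent C x u"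
    "\<forall>\<epsilon>>0. \<forall>\<^sub>F z in at x. z \<in> C \<longrightarrow> (\<exists>u. A u = 0 \<and> norm (z - x - u) \<le> \<epsilon> * norm (z - x))"
proof -
  obtain N and E :: "'a set" and H :: "'a \<Rightarrow> 'a" where N: "open N" "x \<in> N" and E: "subspace E" "dim E = DIM('a) - d"
    and HE: "H ` N \<subseteq> E" and C1: "cont_diff_on H N" and CN: "C \<inter> N = {z \<in> N. H z = 0}"
    and rank: "dim (range (frechet_derivative H (at x))) = DIM('a) - d"
    using assms(1)[unfolded embedded_submanifold_def, THEN conjunct2, rule_format, OF assms(2)]
    by (elim exE conjE) (rule that)
  obtain H' where H': "\<forall>z\<in>N. (H has_derivative blinfun_apply (H' z)) (at z)" "continuous_on N H'"
    using C1 unfolding cont_diff_on_def by (elim exE conjE) (rule that)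
  note H = H'(1)[rule_format] H'(2)
  have A: "frechet_derivative H (at x) = H' x"
    using frechet_derivative_at[OF H(1)[OF N(2)]] by simp
  \<comment> \<open>Difference quotients of \<open>H\<close> at \<open>x\<close> lie in the subspace
    \<open>E\<close>, which is closed, so their limits do too.\<close>
  have "H' x w \<in> E" for w
  proof (rule Lim_in_closed_set[OF closed_subspace[OF E(1)] _ trivial_limit_at_right_real])
    have "((\<lambda>t. x + t *\<^sub>R w) has_derivative (\<lambda>t. t *\<^sub>R w)) (at_right 0)"
      by (auto intro!: derivative_eq_intros)
    from has_derivative_compose[OF this, of H "H' x"] H(1)[OF N(2)]
    have "((\<lambda>t. H (x + t *\<^sub>R w)) has_vector_derivative H' x w) (at_right 0)"
      by (simp add: has_vector_derivative_def blinfun.scaleR_right)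
    from has_vector_derivative_slope_right[OF this]
    show "((\<lambda>t. (H (x + t *\<^sub>R w) - H x) /\<^sub>R t) \<longlongrightarrow> H' x w) (at_right 0)"
      by simp
    have "((\<lambda>t. x + t *\<^sub>R w) \<longlongrightarrow> x + 0 *\<^sub>R w) (at_right 0)"
      by (intro tendsto_intros)
    then have "\<forall>\<^sub>F t in at_right 0. x + t *\<^sub>R w \<in> N"
      using N by (auto dest: topological_tendstoD)
    then show "\<forall>\<^sub>F t in at_right 0. (H (x + t *\<^sub>R w) - H x) /\<^sub>R t \<in> E"
      by eventually_elim (use HE N E(1) in \<open>auto intro!: subspace_scale subspace_diff\<close>)
  qed
  moreover have lin: "linear (H' x)"
    by (simp add: blinfun.bounded_linear_right bounded_linear.linear)
  ultimately have range: "range (H' x) = E"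
    using rank E unfolding A
    by (intro subspace_dim_equal linear_subspace_image) auto
  obtain B where B: "linear B" "\<And>e. e \<in> range (H' x) \<Longrightarrow> H' x (B e) = e"
    using linear_exists_right_inverse_on[OF lin subspace_UNIV] by blast
  define BL where "BL = Blinfun B"
  have BL: "blinfun_apply BL = B"
    unfolding BL_def using B(1) by (simp add: bounded_linear_Blinfun_apply linear_conv_bounded_linear)
  have B1: "H' x (BL (H z)) = H z" if "z \<in> N" for z
    using B(2) HE that range BL by auto
  have B2: "H' x (BL (H' x w)) = H' x w" for w
    using B(2) BL by simp
  show thesis
  proof (rule that[OF N H(1)[OF N(2)]])
    show H0: "\<forall>z\<in>C \<inter> N. H z = 0"
      using CN by blast
    show "\<forall>u. H' x u = 0 \<longrightarrow> regular_tangent C x u"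
      by (intro allI impI regular_tangent_submersion_kernel[OF N CN H B1 B2])
    show "\<forall>\<epsilon>>0. \<forall>\<^sub>F z in at x. z \<in> C \<longrightarrow>
        (\<exists>u. H' x u = 0 \<and> norm (z - x - u) \<le> \<epsilon> * norm (z - x))"
      by (intro allI impI[of "0 < _"] submersion_kernel_approx[OF N H0[rule_format] assms(2) H(1)[OF N(2)] B2])
  qed
qed

section \<open>Transfer of stationarity through the parametrization\<close>

lemma cont_diff_on_UNIV_E:
  assumes "cont_diff_on f UNIV"
  obtains f' where "\<And>x. (f has_derivative blinfun_apply (f' x)) (at x)" "\<And>x. isCont f' x"
  using assms unfolding cont_diff_on_def
  by (elim exE conjE) (rule that, auto simp: continuous_on_eq_continuous_at)

theorem corollary3p4:
  fixes C :: "'x::euclidean_space set"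
    and d :: nat
    and F h :: "'x \<Rightarrow> real"
    and grad_h :: "'x \<Rightarrow> 'x"
    and S :: "'x \<Rightarrow> 'z::euclidean_space"
    and g :: "'z \<Rightarrow> real"
    and \<phi> :: "'y::euclidean_space \<Rightarrow> 'x"
    and L_h L_g \<eta> :: real
    and x_star :: 'x and y_star :: 'y
  assumes C: "C \<noteq> {}" "connected C" "closed C" "embedded_submanifold d C"
    and F: "F = (\<lambda>x. h x + g (S x))"
    and h: "\<And>x. GDERIV h x :> grad_h x" "continuous_on UNIV grad_h"
           "L_h > 0" "L_h-lipschitz_on C grad_h"
    and S: "cont_diff_on S UNIV"
    and g: "L_g > 0" "L_g-lipschitz_on UNIV g" "\<eta> > 0" "weakly_convex \<eta> g"
    and F_bounded: "bdd_below (F ` C)"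
    and \<phi>: "cont_diff_on \<phi> UNIV" "range \<phi> = C"
    and x_star: "x_star = \<phi> y_star"
    and submersion: "range (frechet_derivative \<phi> (at y_star)) = tangent_space C x_star"
  shows "0 \<in> limiting_subdiff (\<lambda>x. ereal (F x) + indicator_fn C x) x_star \<longleftrightarrow>
         0 \<in> limiting_subdiff (\<lambda>y. ereal ((F \<circ> \<phi>) y)) y_star"
proof -
  obtain S' where S': "\<And>x. (S has_derivative blinfun_apply (S' x)) (at x)" "\<And>x. isCont S' x"
    using cont_diff_on_UNIV_E[OF S] by metis
  obtain \<phi>' where \<phi>': "\<And>x. (\<phi> has_derivative blinfun_apply (\<phi>' x)) (at x)" "\<And>x. isCont \<phi>' x"
    using cont_diff_on_UNIV_E[OF \<phi>(1)] by metis
  define h' where "h' x = blinfun_inner_left (grad_h x)" for x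
  have h': "(h has_derivative h' x) (at x)" "isCont h' x" for x
  proof -
    show "(h has_derivative h' x) (at x)"
      using h(1)[of x] by (simp add: gderiv_def h'_def)
    have "isCont grad_h x"
      using h(2) by (simp add: continuous_on_eq_continuous_at)
    then show "isCont h' x"
      unfolding h'_def by (intro bounded_linear.isCont[OF bounded_linear_blinfun_inner_left])
  qed
  have "x_star \<in> C" using \<phi>(2) x_star by blast
  obtain N and H A :: "'x \<Rightarrow> 'x" where N: "open N" "x_star \<in> N" and H: "(H has_derivative A) (at x_star)"
      "\<forall>z\<in>C \<inter> N. H z = 0"
    and ker: "\<forall>u. A u = 0 \<longrightarrow> regular_tangent C x_star u"
    and approx: "\<forall>\<epsilon>>0.
      \<forall>\<^sub>F z in at x_star. z \<in> C \<longrightarrow> (\<exists>u. A u = 0 \<and> norm (z - x_star - u) \<le> \<epsilon> * norm (z - x_star))"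
    by (rule embedded_submanifold_kernel[OF C(4) \<open>x_star \<in> C\<close>]) (rule that)
  \<comment> \<open>\<open>K\<close> lies in the tangent space, which is the range of
    \<open>\<phi>' y_star\<close>, which lies in \<open>K\<close>; the chain of inclusions forces
    equality.\<close>
  define K where "K = {u. A u = 0}"
  have "K \<subseteq> tangent_space C x_star"
  proof
    fix u assume "u \<in> K"
    \<comment> \<open>The normal cone bound is one-sided; applying it to \<open>u\<close> and
      \<open>- u\<close> yields orthogonality.\<close>
    then have "A u = 0" "A (- u) = 0"
      using linear_neg[OF has_derivative_linear[OF H(1)]] by (auto simp: K_def)
    then have "v \<bullet> u \<le> 0" "v \<bullet> (- u) \<le> 0" if "v \<in> normal_cone C x_star" for v
      using that normal_cone_regular_tangent ker by blast+
    then show "u \<in> tangent_space C x_star"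
      unfolding tangent_space_def orthogonal_comp_def orthogonal_def
      by (auto intro: antisym)
  qed
  moreover have range: "range (\<phi>' y_star) = tangent_space C x_star"
    using submersion frechet_derivative_at[OF \<phi>'(1)[of y_star]] by simp
  moreover have "range (\<phi>' y_star) \<subseteq> K"
  proof -
    have "((\<lambda>y. H (\<phi> y)) has_derivative (\<lambda>w. A (\<phi>' y_star w))) (at y_star)"
      by (rule has_derivative_compose[OF \<phi>'(1) H(1)[unfolded x_star]])
    moreover have "isCont \<phi> y_star"
      using \<phi>'(1) has_derivative_continuous by blast
    then have "\<forall>\<^sub>F y in nhds y_star. \<phi> y \<in> N"
      using N x_star unfolding isCont_def tendsto_at_iff_tendsto_nhds by (auto dest: topological_tendstoD)
    then have "\<forall>\<^sub>F y in nhds y_star. H (\<phi> y) = 0"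
      by eventually_elim (use H(2) \<phi>(2) in auto)
    then obtain M where "open M" "y_star \<in> M" "\<And>y. y \<in> M \<Longrightarrow> H (\<phi> y) = 0"
      unfolding eventually_nhds by blast
    then have "((\<lambda>y. H (\<phi> y)) has_derivative (\<lambda>_. 0)) (at y_star)"
      by (auto intro: has_derivative_transform_within_open[OF has_derivative_const, of M])
    ultimately have "(\<lambda>w. A (\<phi>' y_star w)) = (\<lambda>_. 0)"
      by (rule has_derivative_unique)
    then show ?thesis by (auto simp: K_def fun_eq_iff)
  qed
  ultimately have K: "K = range (\<phi>' y_star)" by blast
  have "0 \<in> limiting_subdiff (\<lambda>x. ereal (F x) + indicator_fn C x) x_star \<longleftrightarrow>
    (\<forall>u\<in>K. 0 \<le> h' x_star u + (g (S x_star + S' x_star u) - g (S x_star)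
      + \<eta> / 2 * (norm (S' x_star u))\<^sup>2))"
    unfolding F
  proof (rule zero_limiting_subdiff_iff[OF h' S' g(2,4) _ \<open>x_star \<in> C\<close>])
    show "\<eta> \<ge> 0" using g(3) by simp
    show "regular_tangent C x_star u" if "u \<in> K" for u
      using ker that by (simp add: K_def)
    show "\<forall>\<^sub>F z in at x_star. z \<in> C \<longrightarrow>
        (\<exists>u\<in>K. norm (z - x_star - u) \<le> \<epsilon> * norm (z - x_star))" if "\<epsilon> > 0" for \<epsilon>
      using approx that by (simp add: K_def)
  qed
  \<comment> \<open>Writing each \<open>u\<close> in \<open>K\<close> as
    \<open>\<phi>' y_star w\<close> turns the model at \<open>x_star\<close> into the model at
    \<open>y_star\<close>, whose derivatives are given by the chain rule.\<close>
  also have "\<dots> \<longleftrightarrow> (\<forall>w\<in>UNIV. 0 \<le> (h' (\<phi> y_star) o\<^sub>L \<phi>' y_star) w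
      + (g (S (\<phi> y_star) + (S' (\<phi> y_star) o\<^sub>L \<phi>' y_star) w) - g (S (\<phi> y_star))
      + \<eta> / 2 * (norm ((S' (\<phi> y_star) o\<^sub>L \<phi>' y_star) w))\<^sup>2))"
    by (simp add: K x_star)
  \<comment> \<open>The same criterion is applied with the whole space as both constraint set and
    \<open>K\<close>; its indicator is zero.\<close>
  also have "\<dots> \<longleftrightarrow>
    0 \<in> limiting_subdiff (\<lambda>y. ereal (h (\<phi> y) + g (S (\<phi> y))) + indicator_fn UNIV y) y_star"
  proof (rule zero_limiting_subdiff_iff[symmetric, where L = L_g])
    have cont: "isCont \<phi> y" for y
      using \<phi>'(1) has_derivative_continuous by blast
    have d: "((\<lambda>y. f (\<phi> y)) has_derivative (f' (\<phi> y) o\<^sub>L \<phi>' y)) (at y)"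
      if "\<And>x. (f has_derivative blinfun_apply (f' x)) (at x)"
      for f :: "'x \<Rightarrow> 'w::real_normed_vector" and f' y
      using has_derivative_compose[OF \<phi>'(1) that] by (simp add: blinfun_compose.rep_eq o_def)
    have c: "isCont (\<lambda>y. f' (\<phi> y) o\<^sub>L \<phi>' y) y_star"
      if "\<And>x. isCont f' x" for f' :: "'x \<Rightarrow> 'x \<Rightarrow>\<^sub>L 'w::real_normed_vector"
      by (intro bounded_bilinear.isCont[OF bounded_bilinear_blinfun_compose]
          isCont_o2[OF cont that] \<phi>'(2))
    show "((\<lambda>y. h (\<phi> y)) has_derivative (h' (\<phi> y) o\<^sub>L \<phi>' y)) (at y)"
      "((\<lambda>y. S (\<phi> y)) has_derivative (S' (\<phi> y) o\<^sub>L \<phi>' y)) (at y)" for y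
      by (rule d h' S')+
    show "isCont (\<lambda>y. h' (\<phi> y) o\<^sub>L \<phi>' y) y_star" "isCont (\<lambda>y. S' (\<phi> y) o\<^sub>L \<phi>' y) y_star"
      by (rule c h' S')+
    show "\<forall>\<^sub>F z in at y_star. z \<in> UNIV \<longrightarrow>
        (\<exists>u\<in>UNIV. norm (z - y_star - u) \<le> \<epsilon> * norm (z - y_star))" if "\<epsilon> > 0" for \<epsilon>
    proof (intro always_eventually allI impI)
      fix z show "\<exists>u\<in>UNIV. norm (z - y_star - u) \<le> \<epsilon> * norm (z - y_star)"
        by (rule bexI[of _ "z - y_star"]) (use that in auto)
    qed
  qed (use g regular_tangent_UNIV in auto)
  finally show ?thesis
    by (simp add: F o_def indicator_fn_def)
qed

end
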